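(* Let $R$ be an oriented ray such that all but finitely many arcs of $R$ are in-oriented, or all but finitely many arcs of $R$ are out-oriented. Then $R$ is ubiquitous.
   Context: An oriented ray is a digraph whose underlying undirected graph is a ray (a one-way infinite path). An arc of an oriented ray $R$ is in-oriented if it is directed towards the unique vertex of $R$ whose undirected degree is $1$ (the first vertex of $R$), and out-oriented otherwise. A digraph $H$ is ubiquitous if every digraph $D$ which, for every $k\in\mathbb N$, contains $k$ pairwise vertex-disjoint subdigraphs isomorphic to $H$ also contains infinitely many pairwise vertex-disjoint subdigraphs isomorphic to $H$. *)

theory Defs
  imports "Graph_Theory.Graph_Theory"
begin

definition uedge :: "('a, 'b) pre_digraph \<Rightarrow> 'b \<Rightarrow> 'a set" where
  "uedge G a = {tail G a, head G a}"

text \<open>Bijectivity onto the edge set of the undirected ray says that every edge of the ray carries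
  exactly one arc, so neither parallel nor antiparallel arcs occur.\<close>

definition oriented_ray :: "('a, 'b) pre_digraph \<Rightarrow> bool" where
  "oriented_ray R \<longleftrightarrow> wf_digraph R \<and>
     (\<exists>f :: nat \<Rightarrow> 'a. inj f \<and> verts R = range f \<and>
        bij_betw (uedge R) (arcs R) (range (\<lambda>n. {f n, f (Suc n)})))"

text \<open>Loops would have to be counted twice; the degree is only used for oriented rays, which are
  loopless.\<close>

definition udegree :: "('a, 'b) pre_digraph \<Rightarrow> 'a \<Rightarrow> nat" where
  "udegree G v = card {a \<in> arcs G. v \<in> uedge G a}"

definition first_vertex :: "('a, 'b) pre_digraph \<Rightarrow> 'a" where
  "first_vertex R = (THE v. v \<in> verts R \<and> udegree R v = 1)"

text \<open>Distance in the underlying undirected graph; meaningful for vertices of one component only.\<close>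

definition udist :: "('a, 'b) pre_digraph \<Rightarrow> 'a \<Rightarrow> 'a \<Rightarrow> nat" where
  "udist G u v = (LEAST n. (u, v) \<in> parcs (mk_symmetric G) ^^ n)"

text \<open>An arc points towards the first vertex if its head is closer to it than its tail.\<close>

definition in_oriented :: "('a, 'b) pre_digraph \<Rightarrow> 'b \<Rightarrow> bool" where
  "in_oriented R a \<longleftrightarrow> a \<in> arcs R \<and>
     udist R (first_vertex R) (head R a) < udist R (first_vertex R) (tail R a)"

definition out_oriented :: "('a, 'b) pre_digraph \<Rightarrow> 'b \<Rightarrow> bool" where
  "out_oriented R a \<longleftrightarrow> a \<in> arcs R \<and> \<not> in_oriented R a"

definition disjoint_copies ::
  "('c, 'd) pre_digraph \<Rightarrow> ('a, 'b) pre_digraph \<Rightarrow> ('c, 'd) pre_digraph set \<Rightarrow> bool" where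
  "disjoint_copies D H \<C> \<longleftrightarrow>
     (\<forall>C \<in> \<C>. subgraph C D \<and> digraph_iso H C) \<and>
     pairwise (\<lambda>C C'. verts C \<inter> verts C' = {}) \<C>"

text \<open>A definition cannot quantify over the vertex and arc types of \<open>D\<close>, so they are a parameter:
  \<open>H\<close> is ubiquitous if this holds for all types \<open>'c\<close> and \<open>'d\<close>. Digraphs may be infinite and may have
  loops and parallel arcs.\<close>

definition ubiquitous :: "('c, 'd) pre_digraph itself \<Rightarrow> ('a, 'b) pre_digraph \<Rightarrow> bool" where
  "ubiquitous T H \<longleftrightarrow>
     (\<forall>D :: ('c, 'd) pre_digraph. wf_digraph D \<longrightarrow>
        (\<forall>k :: nat. \<exists>\<C>. finite \<C> \<and> card \<C> = k \<and> disjoint_copies D H \<C>) \<longrightarrow>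
        (\<exists>\<C>. infinite \<C> \<and> disjoint_copies D H \<C>))"

end

theory Submission
  imports Defs "HOL-Library.Ramsey"
begin

text \<open>
  Write a copy of \<open>R\<close> as an initial part of \<open>N\<close> arcs followed by a consistently oriented tail. As in
  Halin's theorem, the infinite family is the limit of finite families whose members get longer and
  longer fixed initial segments. When a ray is added, the old tails are rerouted into the tails of a
  large family of new disjoint copies that avoid the fixed segments. The rerouting comes from a
  stable matching: an old tail prefers to leave itself as early as possible, a new tail prefers to be
  entered as late as possible, and stability says exactly that the rerouted tails are disjoint and
  leave some new tail untouched.

  The initial parts of new copies cannot be kept away from the old tails, so only the initial parts
  among themselves and the tails among themselves are kept disjoint. An initial part has \<open>N + 1\<close>
  vertices, hence meets at most \<open>N + 1\<close> of the limiting tails, and by Ramsey's theorem an infinite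
  subfamily is disjoint.
\<close>


section \<open>Rerouting rays along a stable matching\<close>

text \<open>Separates the tails that can stay as they are, \<open>I - A\<close>, from those that
  have enough partners for a matching, \<open>A\<close>. An \<open>i\<close> with at most
  \<open>card I\<close> related \<open>j\<close> is discarded together with these \<open>j\<close>;
  since \<open>(n+1)^2 - (n+1) \<ge> n^2\<close>, the quadratic bound survives each round.\<close>

lemma discard_rarely_related:
  fixes M :: "'i \<Rightarrow> 'j \<Rightarrow> bool"
  assumes "finite I" "finite J" "card I * card I < card J"
  shows "\<exists>A B. A \<subseteq> I \<and> B \<subseteq> J \<and> card A < card B \<and> (\<forall>i\<in>I - A. \<forall>j\<in>B. \<not> M i j) \<and>
           (\<forall>i\<in>A. card A < card {j \<in> B. M i j})"
  using assms
proof (induction "card I" arbitrary: I J)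
  case 0
  then show ?case by (intro exI[of _ I] exI[of _ J]) auto
next
  case (Suc n)
  show ?case
  proof (cases "\<forall>i\<in>I. card I < card {j \<in> J. M i j}")
    case True
    have "card I \<le> card I * card I" by simp
    then have "card I < card J" using Suc.prems by linarith
    with True show ?thesis by (intro exI[of _ I] exI[of _ J]) auto
  next
    case False
    then obtain i where i: "i \<in> I" "card {j \<in> J. M i j} \<le> card I" by force
    define J' where "J' = J - {j \<in> J. M i j}"
    have cI: "card (I - {i}) = n" using i Suc by simp
    have "card J' = card J - card {j \<in> J. M i j}"
      unfolding J'_def using Suc.prems by (intro card_Diff_subset) auto
    moreover have "card I = Suc n" using Suc by simp
    ultimately have "n * n < card J'" using Suc.prems i by auto
    with cI Suc.prems have "\<exists>A B. A \<subseteq> I - {i} \<and> B \<subseteq> J' \<and> card A < card B \<and>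
        (\<forall>k\<in>(I - {i}) - A. \<forall>j\<in>B. \<not> M k j) \<and> (\<forall>k\<in>A. card A < card {j \<in> B. M k j})"
      by (intro Suc.hyps(1)) (auto simp: J'_def)
    then obtain A B where AB: "A \<subseteq> I - {i}" "B \<subseteq> J'" "card A < card B"
        "\<forall>k\<in>(I - {i}) - A. \<forall>j\<in>B. \<not> M k j" "\<forall>k\<in>A. card A < card {j \<in> B. M k j}"
      by blast
    have "\<forall>k\<in>I - A. \<forall>j\<in>B. \<not> M k j"
      using AB(2,4) unfolding J'_def by blast
    moreover have "A \<subseteq> I" "B \<subseteq> J" using AB unfolding J'_def by auto
    ultimately show ?thesis using AB by blast
  qed
qed

text \<open>The last conclusion is stability: \<open>U i\<close> passes by a meeting with
  \<open>T j\<close> only if some \<open>k\<close> is matched to \<open>T j\<close> and enters it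
  further along. One ray may meet another infinitely often, so preference lists can be infinite;
  \<open>many\<close> is what bounds the proposals.\<close>

lemma stable_matching:
  fixes U :: "'i \<Rightarrow> nat \<Rightarrow> 'v" and T :: "'j \<Rightarrow> nat \<Rightarrow> 'v"
  assumes fin: "finite A" "finite B"
    and injU: "inj_on (case_prod U) (A \<times> UNIV)"
    and injT: "inj_on (case_prod T) (B \<times> UNIV)"
    and many: "\<And>i. i \<in> A \<Longrightarrow> card A < card {j \<in> B. \<exists>m r. U i m = T j r}"
  obtains \<sigma> p q where "inj_on \<sigma> A" "\<sigma> ` A \<subseteq> B" "\<And>i. i \<in> A \<Longrightarrow> U i (p i) = T (\<sigma> i) (q i)"
    "\<And>i m j r. i \<in> A \<Longrightarrow> m < p i \<Longrightarrow> j \<in> B \<Longrightarrow> U i m = T j r \<Longrightarrow> \<exists>k\<in>A. \<sigma> k = j \<and> r < q k"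
proof -
  have Ueq: "i = k \<and> m = r" if "U i m = U k r" "i \<in> A" "k \<in> A" for i k m r
    using inj_onD[OF injU, of "(i, m)" "(k, r)"] that by simp
  have Teq: "i = k \<and> m = r" if "T i m = T k r" "i \<in> B" "k \<in> B" for i k m r
    using inj_onD[OF injT, of "(i, m)" "(k, r)"] that by simp
  \<comment> \<open>A stage of the Gale-Shapley algorithm: \<open>i\<close> proposes at position \<open>p i\<close>, and every earlier
    proposal has been beaten by a later entry into the same \<open>T j\<close>. A maximal stage is stable.\<close>
  define valid where "valid p \<longleftrightarrow> (\<forall>i\<in>A. \<forall>m<p i. \<forall>j\<in>B. \<forall>r. U i m = T j r \<longrightarrow>
      (\<exists>k\<in>A. \<exists>s>r. U k (p k) = T j s))" for p :: "'i \<Rightarrow> nat"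
  \<comment> \<open>Let \<open>\<mu> j\<close> be a position where \<open>U i\<close> meets
    \<open>T j\<close>. Once \<open>p i\<close> has passed all of these, every \<open>T j\<close>
    with \<open>j\<close> in \<open>C\<close> is held by some \<open>k\<close> in \<open>A\<close>.
    Different \<open>j\<close> need different \<open>k\<close>, since the point
    \<open>U k (p k)\<close> lies on only one \<open>T j\<close>; but \<open>C\<close> has more
    elements than \<open>A\<close>.\<close>
  have "\<exists>b. \<forall>p. valid p \<longrightarrow> p i \<le> b" if i: "i \<in> A" for i
  proof -
    define C where "C = {j \<in> B. \<exists>m r. U i m = T j r}"
    have finC: "finite C" unfolding C_def using fin by auto
    have "\<forall>j\<in>C. \<exists>m. \<exists>r. U i m = T j r" unfolding C_def by simp
    then obtain \<mu> where \<mu>: "\<And>j. j \<in> C \<Longrightarrow> \<exists>r. U i (\<mu> j) = T j r"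
      using bchoice[of C "\<lambda>j m. \<exists>r. U i m = T j r"] by blast
    have "p i \<le> (\<Sum>j\<in>C. \<mu> j)" if p: "valid p" for p
    proof (rule ccontr)
      assume "\<not> p i \<le> (\<Sum>j\<in>C. \<mu> j)"
      then have less: "\<mu> j < p i" if "j \<in> C" for j
        using member_le_sum[of j C \<mu>] that finC by simp
      have "\<exists>k. k \<in> A \<and> (\<exists>s. U k (p k) = T j s)" if j: "j \<in> C" for j
      proof -
        have "j \<in> B" using j C_def by auto
        moreover obtain r where "U i (\<mu> j) = T j r" using \<mu>[OF j] by blast
        ultimately show ?thesis using p less[OF j] i unfolding valid_def by blast
      qed
      then obtain h where h: "\<And>j. j \<in> C \<Longrightarrow> h j \<in> A \<and> (\<exists>s. U (h j) (p (h j)) = T j s)"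
        by metis
      have "inj_on h C"
      proof (rule inj_onI)
        fix j j' assume jj: "j \<in> C" "j' \<in> C" "h j = h j'"
        then obtain s s' where "T j s = T j' s'" using h by metis
        then show "j = j'" using Teq jj unfolding C_def by blast
      qed
      then have "card C \<le> card A"
        using h fin by (intro card_inj_on_le) auto
      then show False using many[OF i] unfolding C_def by simp
    qed
    then show ?thesis by blast
  qed
  then obtain b where b: "\<And>i p. i \<in> A \<Longrightarrow> valid p \<Longrightarrow> p i \<le> b i" by metis
  have "valid (\<lambda>_. 0)" unfolding valid_def by simp
  moreover have "\<forall>p. valid p \<longrightarrow> sum p A \<le> sum b A"
    using b by (auto intro: sum_mono)
  ultimately obtain p where p: "valid p" and max: "\<And>p'. valid p' \<Longrightarrow> sum p' A \<le> sum p A"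
    using ex_has_greatest_nat[of valid "\<lambda>_. 0" "\<lambda>p. sum p A" "Suc (sum b A)"] by (auto simp: less_Suc_eq_le)
  \<comment> \<open>By maximality of the sum no single proposal can be advanced. Advancing
    \<open>i\<close> would keep the stage valid if its position lay on no \<open>T j\<close>, or if
    another \<open>k\<close> held the same \<open>T j\<close> further along. Hence every
    \<open>i\<close> is at some \<open>T j\<close>, and no two are at the same one.\<close>
  have stuck: "\<not> valid (p(i := Suc (p i)))" if i: "i \<in> A" for i
  proof
    assume "valid (p(i := Suc (p i)))"
    then have "sum (p(i := Suc (p i))) A \<le> sum p A" by (rule max)
    moreover have "sum p A < sum (p(i := Suc (p i))) A"
      using i fin by (intro sum_strict_mono_ex1) auto
    ultimately show False by simp
  qed
  have "\<exists>j\<in>B. \<exists>r. U i (p i) = T j r" if i: "i \<in> A" for i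
  proof (rule ccontr)
    assume no: "\<not> ?thesis"
    have "valid (p(i := Suc (p i)))"
      unfolding valid_def
    proof (intro ballI allI impI)
      fix l m j r
      assume *: "l \<in> A" "m < (p(i := Suc (p i))) l" "j \<in> B" "U l m = T j r"
      then have "m < p l" using no by (auto split: if_splits simp: less_Suc_eq)
      then obtain k s where k: "k \<in> A" "s > r" "U k (p k) = T j s"
        using p * unfolding valid_def by blast
      then have "k \<noteq> i" using no * by auto
      then show "\<exists>k\<in>A. \<exists>s>r. U k ((p(i := Suc (p i))) k) = T j s"
        using k by auto
    qed
    with stuck[OF i] show False by blast
  qed
  then obtain \<sigma> q where \<sigma>: "\<And>i. i \<in> A \<Longrightarrow> \<sigma> i \<in> B" and q: "\<And>i. i \<in> A \<Longrightarrow> U i (p i) = T (\<sigma> i) (q i)"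
    by metis
  have no_later: False
    if ik: "i \<in> A" "k \<in> A" "\<sigma> i = \<sigma> k" "q i < q k" for i k
  proof -
    have ne: "k \<noteq> i" using ik by auto
    have "valid (p(i := Suc (p i)))"
      unfolding valid_def
    proof (intro ballI allI impI)
      fix l m j r
      assume *: "l \<in> A" "m < (p(i := Suc (p i))) l" "j \<in> B" "U l m = T j r"
      show "\<exists>k\<in>A. \<exists>s>r. U k ((p(i := Suc (p i))) k) = T j s"
      proof (cases "m < p l")
        case True
        then obtain k' s where k': "k' \<in> A" "s > r" "U k' (p k') = T j s"
          using p * unfolding valid_def by blast
        \<comment> \<open>The later entry that beat the earlier proposal may belong to
          \<open>i\<close> itself, which is about to move on; then \<open>k\<close>, still further
          along the same \<open>T j\<close>, takes over.\<close>
        show ?thesis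
        proof (cases "k' = i")
          case True
          then have "T j s = T (\<sigma> i) (q i)" using k'(3) q[OF ik(1)] by simp
          then have "j = \<sigma> i" "s = q i" using Teq *(3) \<sigma>[OF ik(1)] by blast+
          then show ?thesis using ik ne k' q[of k]
            by (intro bexI[of _ k] exI[of _ "q k"]) auto
        next
          case False
          then show ?thesis using k' by auto
        qed
      next
        case False
        then have "l = i" "m = p i" using *(2) by (auto split: if_splits)
        then have "T j r = T (\<sigma> i) (q i)" using *(4) q[OF ik(1)] by simp
        then have "j = \<sigma> i" "r = q i" using Teq *(3) \<sigma>[OF ik(1)] by blast+
        then show ?thesis using ik ne q[of k]
          by (intro bexI[of _ k] exI[of _ "q k"]) auto
      qed
    qed
    with stuck ik show False by blast
  qed
  have "inj_on \<sigma> A"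
  proof (rule inj_onI)
    fix i k assume ik: "i \<in> A" "k \<in> A" "\<sigma> i = \<sigma> k"
    then have "q i = q k" using no_later[of i k] no_later[of k i] by fastforce
    then show "i = k" using q[of i] q[of k] Ueq[of i "p i" k "p k"] ik by simp
  qed
  moreover have "\<exists>k\<in>A. \<sigma> k = j \<and> r < q k"
    if *: "i \<in> A" "m < p i" "j \<in> B" "U i m = T j r" for i m j r
  proof -
    obtain k s where k: "k \<in> A" "s > r" "U k (p k) = T j s"
      using p * unfolding valid_def by blast
    then have "T j s = T (\<sigma> k) (q k)" using q[of k] by simp
    then have "\<sigma> k = j" "q k = s" using Teq *(3) \<sigma>[OF k(1)] by blast+
    then show ?thesis using k by auto
  qed
  ultimately show ?thesis using \<sigma> q by (intro that[of \<sigma> p q]) auto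
qed

text \<open>Rays in \<open>A\<close> follow \<open>U i\<close> up to \<open>p i\<close> and then the
  matched \<open>T (\<sigma> i)\<close>; rays in \<open>I - A\<close> keep their course, as they
  miss every \<open>T\<close> in \<open>B\<close>. Since \<open>card A < card B\<close>, some
  \<open>T j\<close> in \<open>B\<close> is unmatched, and by stability no \<open>U i\<close> meets
  it before \<open>p i\<close>, as this would force a \<open>k\<close> matched to \<open>j\<close>.
  So it stays free for a new ray.\<close>

lemma reroute_rays:
  fixes U :: "'i \<Rightarrow> nat \<Rightarrow> 'v" and T :: "'j \<Rightarrow> nat \<Rightarrow> 'v"
  assumes fin: "finite I" "finite J" and card: "card I * card I < card J"
    and injU: "inj_on (case_prod U) (I \<times> UNIV)"
    and injT: "inj_on (case_prod T) (J \<times> UNIV)"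
    and EU: "\<And>i n. i \<in> I \<Longrightarrow> E (U i n) (U i (Suc n))"
    and ET: "\<And>j n. j \<in> J \<Longrightarrow> E (T j n) (T j (Suc n))"
  obtains j U' where "j \<in> J" "inj_on (case_prod U') (I \<times> UNIV)"
    "\<And>i. i \<in> I \<Longrightarrow> U' i 0 = U i 0"
    "\<And>i n. i \<in> I \<Longrightarrow> E (U' i n) (U' i (Suc n))"
    "\<And>i n. i \<in> I \<Longrightarrow> U' i n \<in> case_prod U ` (I \<times> UNIV) \<union> case_prod T ` (J \<times> UNIV)"
    "\<And>i n. i \<in> I \<Longrightarrow> U' i n \<notin> range (T j)"
proof -
  have Ueq: "i = k \<and> m = r" if "U i m = U k r" "i \<in> I" "k \<in> I" for i k m r
    using inj_onD[OF injU, of "(i, m)" "(k, r)"] that by simp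
  have Teq: "i = k \<and> m = r" if "T i m = T k r" "i \<in> J" "k \<in> J" for i k m r
    using inj_onD[OF injT, of "(i, m)" "(k, r)"] that by simp
  obtain A B where AB: "A \<subseteq> I" "B \<subseteq> J" "card A < card B"
    and avoid: "\<forall>i\<in>I - A. \<forall>j\<in>B. \<not> (\<exists>m r. U i m = T j r)"
    and many: "\<forall>i\<in>A. card A < card {j \<in> B. \<exists>m r. U i m = T j r}"
    using discard_rarely_related[OF fin card, of "\<lambda>i j. \<exists>m r. U i m = T j r"] by blast
  have finAB: "finite A" "finite B" using AB fin finite_subset by blast+
  have injAB: "inj_on (case_prod U) (A \<times> UNIV)" "inj_on (case_prod T) (B \<times> UNIV)"
    using AB by (auto intro: inj_on_subset[OF injU] inj_on_subset[OF injT])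
  obtain p \<sigma> q
    where inj\<sigma>: "inj_on \<sigma> A" and \<sigma>: "\<sigma> ` A \<subseteq> B" and q: "\<And>i. i \<in> A \<Longrightarrow> U i (p i) = T (\<sigma> i) (q i)"
      and stable: "\<And>i m j r. i \<in> A \<Longrightarrow> m < p i \<Longrightarrow> j \<in> B \<Longrightarrow> U i m = T j r \<Longrightarrow> \<exists>k\<in>A. \<sigma> k = j \<and> r < q k"
  proof -
    show thesis by (rule stable_matching[OF finAB injAB many[rule_format]]) (assumption, fact that)
  qed
  have "card (\<sigma> ` A) < card B" using AB(3) card_image_le[OF finAB(1), of \<sigma>] by simp
  then obtain j where j: "j \<in> B" "j \<notin> \<sigma> ` A"
    using \<sigma> finAB by (metis less_irrefl subsetI subset_antisym)
  define U' where "U' i n = (if i \<in> A \<and> p i \<le> n then T (\<sigma> i) (q i + (n - p i)) else U i n)" for i n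
  have stable': "r < q k" if *: "i \<in> A" "m < p i" "k \<in> A" "U i m = T (\<sigma> k) r" for i k m r
  proof -
    have "\<sigma> k \<in> B" using \<sigma> *(3) by auto
    from stable[OF *(1,2) this *(4)] obtain k' where "k' \<in> A" "\<sigma> k' = \<sigma> k" "r < q k'" by blast
    then show ?thesis using inj_onD[OF inj\<sigma>, of k' k] *(3) by simp
  qed
  show ?thesis
  proof (rule that[of j U'])
    show "j \<in> J" using j AB by auto
    have cross: False
      if "i \<in> I" "\<not> (i \<in> A \<and> p i \<le> n)" "k \<in> A" "U i n = T (\<sigma> k) (q k + r)" for i n k r
    proof (cases "i \<in> A")
      case True
      then show ?thesis using stable'[of i n k "q k + r"] that by auto
    next
      case False
      then show ?thesis using avoid that \<sigma> by blast
    qed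
    show "inj_on (case_prod U') (I \<times> UNIV)"
    proof (rule inj_onI, clarify)
      fix i n k m assume *: "i \<in> I" "k \<in> I" "U' i n = U' k m"
      show "i = k \<and> n = m"
      proof (cases "i \<in> A \<and> p i \<le> n"; cases "k \<in> A \<and> p k \<le> m")
        assume a: "i \<in> A \<and> p i \<le> n" "k \<in> A \<and> p k \<le> m"
        then have eq: "T (\<sigma> i) (q i + (n - p i)) = T (\<sigma> k) (q k + (m - p k))"
          using * unfolding U'_def by simp
        moreover have "\<sigma> i \<in> J" "\<sigma> k \<in> J" using a \<sigma> AB by auto
        ultimately have "\<sigma> i = \<sigma> k" "q i + (n - p i) = q k + (m - p k)" using Teq by blast+
        then show ?thesis using inj_onD[OF inj\<sigma>, of i k] a by auto
      next
        assume a: "i \<in> A \<and> p i \<le> n" "\<not> (k \<in> A \<and> p k \<le> m)"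
        then show ?thesis using * cross[of k m i "n - p i"] unfolding U'_def by auto
      next
        assume a: "\<not> (i \<in> A \<and> p i \<le> n)" "k \<in> A \<and> p k \<le> m"
        then show ?thesis using * cross[of i n k "m - p k"] unfolding U'_def by auto
      next
        assume a: "\<not> (i \<in> A \<and> p i \<le> n)" "\<not> (k \<in> A \<and> p k \<le> m)"
        then show ?thesis using * Ueq[of i n k m] unfolding U'_def by auto
      qed
    qed
    fix i assume i: "i \<in> I"
    show "U' i 0 = U i 0" unfolding U'_def using q[of i] by auto
    fix n
    \<comment> \<open>At the switching position \<open>n = p i\<close> both branches of
      \<open>U'\<close> give the same vertex, so the step into it is still a step of
      \<open>U i\<close>.\<close>
    have *: "U' i n = U i n" if "i \<in> A \<longrightarrow> n \<le> p i" for n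
      using that q[of i] unfolding U'_def by auto
    show "E (U' i n) (U' i (Suc n))"
    proof (cases "i \<in> A \<and> p i \<le> n")
      case True
      then have "\<sigma> i \<in> J" using \<sigma> AB by auto
      then show ?thesis using True ET[of "\<sigma> i" "q i + (n - p i)"] unfolding U'_def
        by (simp add: Suc_diff_le)
    next
      case False
      then show ?thesis using *[of n] *[of "Suc n"] EU[OF i, of n] by auto
    qed
    show "U' i n \<in> case_prod U ` (I \<times> UNIV) \<union> case_prod T ` (J \<times> UNIV)"
    proof (cases "i \<in> A \<and> p i \<le> n")
      case True
      then have "\<sigma> i \<in> J" using \<sigma> AB by auto
      then show ?thesis using True unfolding U'_def by force
    next
      case False
      then show ?thesis using i unfolding U'_def by force
    qed
    show "U' i n \<notin> range (T j)"
    proof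
      assume "U' i n \<in> range (T j)"
      then obtain r where r: "U' i n = T j r" by auto
      show False
      proof (cases "i \<in> A \<and> p i \<le> n")
        case True
        then have "\<sigma> i \<in> J" "j \<in> J" using \<sigma> AB j by auto
        then have "\<sigma> i = j" using Teq r True unfolding U'_def by metis
        then show ?thesis using j True by auto
      next
        case False
        then have eq: "U i n = T j r" using r unfolding U'_def by auto
        show ?thesis
        proof (cases "i \<in> A")
          case True
          then show ?thesis using False stable[of i n j r] eq j by auto
        next
          case False
          then show ?thesis using avoid eq i j by blast
        qed
      qed
    qed
  qed
qed

section \<open>Infinite families of rays\<close>

text \<open>Initial parts may still meet foreign tails: \<open>thin_nearly_disjoint\<close> repairs this at the very end,
  whereas demanding full disjointness at every stage would break the extension step.\<close>

definition nearly_disjoint ::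
  "(nat \<Rightarrow> 'v \<Rightarrow> 'v \<Rightarrow> bool) \<Rightarrow> nat \<Rightarrow> 'i set \<Rightarrow> ('i \<Rightarrow> nat \<Rightarrow> 'v) \<Rightarrow> bool" where
  "nearly_disjoint W N I g \<longleftrightarrow>
     (\<forall>i\<in>I. inj (g i) \<and> (\<forall>n. W n (g i n) (g i (Suc n)))) \<and>
     inj_on (case_prod g) (I \<times> {..N}) \<and> inj_on (case_prod g) (I \<times> {N..})"

text \<open>Merges the three injectivity conditions into one pointwise condition suited to case
  distinctions. Position \<open>N\<close> belongs both to the initial part and to the tail.\<close>

lemma nearly_disjoint_iff:
  "nearly_disjoint W N I g \<longleftrightarrow>
     (\<forall>i\<in>I. \<forall>n. W n (g i n) (g i (Suc n))) \<and>
     (\<forall>i\<in>I. \<forall>k\<in>I. \<forall>m r. g i m = g k r \<longrightarrow> i = k \<or> m \<le> N \<and> r \<le> N \<or> N \<le> m \<and> N \<le> r \<longrightarrow>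
        i = k \<and> m = r)" (is "_ \<longleftrightarrow> _ \<and> ?inj")
proof -
  have "?inj" if g: "\<forall>i\<in>I. inj (g i)" "inj_on (case_prod g) (I \<times> {..N})" "inj_on (case_prod g) (I \<times> {N..})"
  proof (intro ballI allI impI)
    fix i k m r assume ik: "i \<in> I" "k \<in> I" and eq: "g i m = g k r"
      and "i = k \<or> m \<le> N \<and> r \<le> N \<or> N \<le> m \<and> N \<le> r"
    then consider "i = k" | "m \<le> N" "r \<le> N" | "N \<le> m" "N \<le> r" by blast
    then show "i = k \<and> m = r"
    proof cases
      case 1
      then show ?thesis using g(1) ik eq by (auto dest: injD)
    next
      case 2
      then show ?thesis using inj_onD[OF g(2), of "(i, m)" "(k, r)"] ik eq by simp
    next
      case 3
      then show ?thesis using inj_onD[OF g(3), of "(i, m)" "(k, r)"] ik eq by simp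
    qed
  qed
  moreover have "(\<forall>i\<in>I. inj (g i)) \<and> inj_on (case_prod g) (I \<times> {..N}) \<and> inj_on (case_prod g) (I \<times> {N..})"
    if ?inj
    using that by (intro conjI ballI injI inj_onI) (clarsimp | blast)+
  ultimately show ?thesis unfolding nearly_disjoint_def by blast
qed

text \<open>The rays are disjoint, so each point of \<open>F\<close> spoils at most one of
  them.\<close>

lemma card_avoiding_rays:
  fixes h :: "nat \<Rightarrow> 'a \<Rightarrow> 'v"
  assumes "finite F" and inj: "inj_on (case_prod h) ({..<k} \<times> UNIV)"
  shows "k \<le> card {j. j < k \<and> range (h j) \<inter> F = {}} + card F"
proof -
  define X where "X = {j. j < k \<and> range (h j) \<inter> F \<noteq> {}}"
  have "\<forall>j\<in>X. \<exists>x. x \<in> range (h j) \<inter> F" unfolding X_def by auto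
  then obtain c where c: "\<And>j. j \<in> X \<Longrightarrow> c j \<in> range (h j) \<inter> F"
    using bchoice[of X "\<lambda>j x. x \<in> range (h j) \<inter> F"] by blast
  have "inj_on c X"
  proof (rule inj_onI)
    fix i j assume ij: "i \<in> X" "j \<in> X" "c i = c j"
    then obtain a b where "h i a = h j b" using c[of i] c[of j] by auto
    then show "i = j" using inj_onD[OF inj, of "(i, a)" "(j, b)"] ij unfolding X_def by auto
  qed
  then have "card X \<le> card F" using c assms(1) by (intro card_inj_on_le) auto
  moreover have "{..<k} = {j. j < k \<and> range (h j) \<inter> F = {}} \<union> X" unfolding X_def by auto
  then have "k \<le> card {j. j < k \<and> range (h j) \<inter> F = {}} + card X"
    by (metis card_Un_le card_lessThan)
  ultimately show ?thesis by simp
qed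

lemma extend_nearly_disjoint:
  fixes g :: "nat \<Rightarrow> nat \<Rightarrow> 'v"
  assumes WE: "\<And>m. N \<le> m \<Longrightarrow> W m = E"
    and many: "\<And>k::nat. \<exists>h. inj_on (case_prod h) ({..<k} \<times> (UNIV :: nat set)) \<and>
                 (\<forall>i<k. \<forall>m. W m (h i m) (h i (Suc m)))"
    and g: "nearly_disjoint W N {..<n} g"
  shows "\<exists>g' l'. l < l' \<and> nearly_disjoint W N {..<Suc n} g' \<and> (\<forall>i<n. \<forall>m\<le>l'. g' i m = g i m)"
proof -
  have gW: "W m (g i m) (g i (Suc m))" if "i < n" for i m
    using g that unfolding nearly_disjoint_iff by auto
  have geq: "i = k \<and> m = r"
    if "g i m = g k r" "i < n" "k < n" "i = k \<or> m \<le> N \<and> r \<le> N \<or> N \<le> m \<and> N \<le> r" for i k m r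
    using g that unfolding nearly_disjoint_iff by blast
  have ginj: "inj (g i)" if "i < n" for i
    using geq that by (intro injI) blast
  \<comment> \<open>The old tails may run through the initial parts \<open>P\<close>, but
    \<open>P\<close> is finite, so each tail leaves it for good. The position \<open>l'\<close> lies
    beyond that moment, beyond \<open>N\<close> and beyond \<open>l\<close>.\<close>
  define P where "P = case_prod g ` ({..<n} \<times> {..N})"
  have "finite P" unfolding P_def by auto
  then have "finite (\<Union>i<n. g i -` P)" using ginj by (auto intro: finite_vimageI)
  then obtain b where b: "(\<Union>i<n. g i -` P) \<subseteq> {..<b}" using finite_nat_bounded by blast
  define l' where "l' = Suc (l + N + b)"
  have l': "l < l'" "N < l'" unfolding l'_def by auto
  have avoidP: "g i m \<notin> P" if "i < n" "l' \<le> m" for i m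
    using b that unfolding l'_def by fastforce
  define F where "F = case_prod g ` ({..<n} \<times> {..l'})"
  have F: "finite F" unfolding F_def by auto
  have inF: "g i m \<in> F" if "i < n" "m \<le> l'" for i m
    unfolding F_def using that by force
  \<comment> \<open>At most \<open>card F\<close> of these rays meet \<open>F\<close>, which leaves
    more than \<open>n * n\<close> for the rerouting.\<close>
  obtain h where hinj: "inj_on (case_prod h) ({..<Suc (n * n + card F)} \<times> (UNIV :: nat set))"
    and hW: "\<And>i m. i < Suc (n * n + card F) \<Longrightarrow> W m (h i m) (h i (Suc m))"
    using many by blast
  define J where "J = {j. j < Suc (n * n + card F) \<and> range (h j) \<inter> F = {}}"
  have cardJ: "card {..<n} * card {..<n} < card J"
    using card_avoiding_rays[OF F hinj] unfolding J_def by simp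
  have finJ: "finite J" unfolding J_def by auto
  have heq: "i = k \<and> m = r" if "h i m = h k r" "i \<in> J" "k \<in> J" for i k m r
    using inj_onD[OF hinj, of "(i, m)" "(k, r)"] that unfolding J_def by auto
  have hF: "h i m \<notin> F" if "i \<in> J" for i m
    using that unfolding J_def by auto
  \<comment> \<open>Splicing an old tail into a new one requires every step to be \<open>E\<close>,
    hence the starting positions \<open>l' > N\<close> and \<open>N\<close>.\<close>
  define U where "U i m = g i (l' + m)" for i m
  define T where "T j m = h j (N + m)" for j m
  have injU: "inj_on (case_prod U) ({..<n} \<times> UNIV)"
    unfolding U_def using l' by (auto intro!: inj_onI dest: geq)
  have injT: "inj_on (case_prod T) (J \<times> UNIV)"
    unfolding T_def by (auto intro!: inj_onI dest!: heq)
  have EU: "E (U i m) (U i (Suc m))" if "i \<in> {..<n}" for i m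
    using gW[of i "l' + m"] WE[of "l' + m"] that l' unfolding U_def by simp
  have ET: "E (T j m) (T j (Suc m))" if "j \<in> J" for j m
    using hW[of j "N + m"] WE[of "N + m"] that unfolding T_def J_def by simp
  obtain j U' where j: "j \<in> J" and injU': "inj_on (case_prod U') ({..<n} \<times> UNIV)"
    and U'0: "\<And>i. i \<in> {..<n} \<Longrightarrow> U' i 0 = U i 0"
    and U'E: "\<And>i m. i \<in> {..<n} \<Longrightarrow> E (U' i m) (U' i (Suc m))"
    and U'in: "\<And>i m. i \<in> {..<n} \<Longrightarrow>
                 U' i m \<in> case_prod U ` ({..<n} \<times> UNIV) \<union> case_prod T ` (J \<times> UNIV)"
    and U'T: "\<And>i m. i \<in> {..<n} \<Longrightarrow> U' i m \<notin> range (T j)"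
  proof -
    show thesis by (rule reroute_rays[OF finite_lessThan finJ cardJ injU injT EU ET]) (assumption | fact that)+
  qed
  have U'eq: "i = k \<and> m = r" if "U' i m = U' k r" "i < n" "k < n" for i k m r
    using inj_onD[OF injU', of "(i, m)" "(k, r)"] that by simp
  \<comment> \<open>Position 0 is excluded because \<open>U' i 0\<close> is \<open>g i l'\<close>, a
    point of \<open>F\<close>. Later points lie on new tails, which avoid \<open>F\<close>, or on
    old rays from \<open>l'\<close> on; these avoid \<open>P\<close> and so meet \<open>F\<close>
    only at their own position \<open>l'\<close>, which is already the start of some
    \<open>U' k'\<close>.\<close>
  have U'F: "U' i d \<notin> F" if i: "i < n" and d: "0 < d" for i d
  proof
    assume inF': "U' i d \<in> F"
    then obtain k m where km: "k < n" "m \<le> l'" "U' i d = g k m" unfolding F_def by auto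
    from U'in[of i d] i consider (U) k' r where "k' < n" "U' i d = U k' r"
      | (T) j' r where "j' \<in> J" "U' i d = T j' r" by auto
    then show False
    proof cases
      case U
      then have eq: "g k m = g k' (l' + r)" using km unfolding U_def by simp
      have "\<not> m \<le> N"
      proof
        assume "m \<le> N"
        then have "g k m \<in> P" unfolding P_def using km by force
        then show False using avoidP[of k' "l' + r"] U eq by simp
      qed
      then have "m = l' + r" using geq[OF eq km(1) U(1)] l' by simp
      then have "r = 0" using km by simp
      then have "U' i d = U' k' 0" using U U'0[of k'] by simp
      then show False using U'eq[of i d k' 0] i U d by simp
    next
      case T
      then show False using hF[of j' "N + r"] inF' unfolding T_def by simp
    qed
  qed
  define g' where "g' i m = (if i < n then if m \<le> l' then g i m else U' i (m - l') else h j m)" for i m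
  have g'low: "g' i m = g i m" if "i < n" "m \<le> l'" for i m
    unfolding g'_def using that by simp
  have g'high: "g' i m = U' i (m - l')" if "i < n" "l' \<le> m" for i m
    unfolding g'_def using that U'0[of i] U_def by auto
  have g'n: "g' n m = h j m" for m unfolding g'_def by simp
  have old: "i = k \<and> m = r"
    if eq: "g' i m = g' k r" and ik: "i < n" "k < n"
      and c: "i = k \<or> m \<le> N \<and> r \<le> N \<or> N \<le> m \<and> N \<le> r" for i k m r
  proof (cases "m \<le> l'"; cases "r \<le> l'")
    assume a: "m \<le> l'" "r \<le> l'"
    then have "g i m = g k r" using eq ik g'low by simp
    then show ?thesis using geq c ik by blast
  next
    assume a: "m \<le> l'" "\<not> r \<le> l'"
    then have "g i m = U' k (r - l')" using eq ik g'low g'high by simp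
    then show ?thesis using U'F[of k "r - l'"] inF[of i m] a ik by simp
  next
    assume a: "\<not> m \<le> l'" "r \<le> l'"
    then have "U' i (m - l') = g k r" using eq ik g'low g'high by simp
    then show ?thesis using U'F[of i "m - l'"] inF[of k r] a ik by simp
  next
    assume a: "\<not> m \<le> l'" "\<not> r \<le> l'"
    then have "U' i (m - l') = U' k (r - l')" using eq ik g'high by simp
    then show ?thesis using U'eq[of i "m - l'" k "r - l'"] a ik by auto
  qed
  \<comment> \<open>Frozen points lie in \<open>F\<close>, which \<open>h j\<close> avoids, and
    rerouted tails avoid \<open>T j\<close>. The condition \<open>c\<close> leaves out the case of a
    rerouted tail meeting the initial part of \<open>h j\<close>, which can occur.\<close>
  have new: False if eq: "g' i m = g' n r" and i: "i < n" and c: "m \<le> N \<or> N \<le> r" for i m r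
  proof (cases "m \<le> l'")
    case True
    then have "g i m = h j r" using eq i g'low g'n by simp
    then show ?thesis using inF[of i m] hF[OF j, of r] True i by simp
  next
    case False
    then have "U' i (m - l') = T j (r - N)" using eq i g'high g'n c l' unfolding T_def by simp
    then show ?thesis using U'T[of i "m - l'"] i by auto
  qed
  have inj': "i = k \<and> m = r"
    if eq: "g' i m = g' k r" and ik: "i < Suc n" "k < Suc n"
      and c: "i = k \<or> m \<le> N \<and> r \<le> N \<or> N \<le> m \<and> N \<le> r" for i k m r
  proof (cases "i = n"; cases "k = n")
    assume "i = n" "k = n"
    then show ?thesis using eq heq[of j m j r] j g'n by simp
  next
    assume "i = n" "k \<noteq> n"
    then show ?thesis using eq new[of k r m] ik c by auto
  next
    assume "i \<noteq> n" "k = n"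
    then show ?thesis using eq new[of i m r] ik c by auto
  next
    assume "i \<noteq> n" "k \<noteq> n"
    then show ?thesis using old[OF eq] ik c by simp
  qed
  have W': "W m (g' i m) (g' i (Suc m))" if i: "i < Suc n" for i m
  proof (cases "i = n")
    case True
    then show ?thesis using hW[of j m] j g'n unfolding J_def by simp
  next
    case False
    then have i: "i < n" using i by simp
    show ?thesis
    proof (cases "m < l'")
      case True
      then show ?thesis using gW[OF i, of m] g'low[OF i, of m] g'low[OF i, of "Suc m"] by simp
    next
      case False
      then show ?thesis
        using U'E[of i "m - l'"] g'high[OF i, of m] g'high[OF i, of "Suc m"] i WE[of m] l'
        by (simp add: Suc_diff_le)
    qed
  qed
  have "nearly_disjoint W N {..<Suc n} g'"
    unfolding nearly_disjoint_iff using inj' W' by (meson lessThan_iff)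
  then show ?thesis using l'(1) g'low by blast
qed

text \<open>A state is a family together with the length up to which the previous rays were frozen.
  These lengths grow strictly, so each position of each ray is eventually constant and the stages
  have a limit.\<close>

lemma infinite_nearly_disjoint:
  fixes W :: "nat \<Rightarrow> 'v \<Rightarrow> 'v \<Rightarrow> bool"
  assumes WE: "\<And>m. N \<le> m \<Longrightarrow> W m = E"
    and many: "\<And>k::nat. \<exists>h. inj_on (case_prod h) ({..<k} \<times> (UNIV :: nat set)) \<and>
                 (\<forall>i<k. \<forall>m. W m (h i m) (h i (Suc m)))"
  shows "\<exists>G. nearly_disjoint W N (UNIV :: nat set) G"
proof -
  have "\<exists>s. \<forall>n. nearly_disjoint W N {..<n} (fst (s n)) \<and>
      (snd (s n) < snd (s (Suc n)) \<and>
       (\<forall>i<n. \<forall>m\<le>snd (s (Suc n)). fst (s (Suc n)) i m = fst (s n) i m))"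
  proof (rule dependent_nat_choice)
    show "\<exists>x. nearly_disjoint W N {..<0::nat} (fst x)"
      unfolding nearly_disjoint_def by auto
    fix x :: "(nat \<Rightarrow> nat \<Rightarrow> 'v) \<times> nat" and n
    assume "nearly_disjoint W N {..<n} (fst x)"
    from extend_nearly_disjoint[OF WE many this, of "snd x"]
    show "\<exists>y. nearly_disjoint W N {..<Suc n} (fst y) \<and>
        (snd x < snd y \<and> (\<forall>i<n. \<forall>m\<le>snd y. fst y i m = fst x i m))"
      by auto
  qed
  then obtain s where s: "\<And>n. nearly_disjoint W N {..<n} (fst (s n))"
    and less: "\<And>n. snd (s n) < snd (s (Suc n))"
    and agree: "\<And>n i m. i < n \<Longrightarrow> m \<le> snd (s (Suc n)) \<Longrightarrow> fst (s (Suc n)) i m = fst (s n) i m"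
    by blast
  have ge: "n \<le> snd (s n)" for n
    using less by (induction n) (auto simp: Suc_le_eq intro: le_less_trans)
  \<comment> \<open>From stage \<open>Suc (i + m)\<close> on, ray \<open>i\<close> is present and
    its position \<open>m\<close> no longer changes, because the length at stage \<open>n\<close> is
    at least \<open>n\<close>.\<close>
  define G where "G i m = fst (s (Suc (i + m))) i m" for i m
  have G: "fst (s n) i m = G i m" if "Suc (i + m) \<le> n" for i m n
    using that
  proof (induction n rule: dec_induct)
    case base
    then show ?case unfolding G_def by simp
  next
    case (step n)
    then show ?case using agree[of i n m] ge[of "Suc n"] by simp
  qed
  \<comment> \<open>Only two positions are involved, so the claim is inherited from one stage
    \<open>n\<close> at which both are final.\<close>
  have "i = k \<and> m = r" if eq: "G i m = G k r"
    and c: "i = k \<or> m \<le> N \<and> r \<le> N \<or> N \<le> m \<and> N \<le> r" for i m k r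
  proof -
    define n where "n = Suc (i + m + k + r)"
    have eq': "fst (s n) i m = fst (s n) k r" using eq G[of i m n] G[of k r n] unfolding n_def by simp
    have lt: "i < n" "k < n" unfolding n_def by auto
    show ?thesis using s[of n] eq' lt c unfolding nearly_disjoint_iff by blast
  qed
  moreover have "W m (G i m) (G i (Suc m))" for i m
  proof -
    have "W m (fst (s (i + m + 2)) i m) (fst (s (i + m + 2)) i (Suc m))"
      using s[of "i + m + 2"] unfolding nearly_disjoint_iff by auto
    then show ?thesis using G[of i m "i + m + 2"] G[of i "Suc m" "i + m + 2"] by simp
  qed
  ultimately have "nearly_disjoint W N UNIV G"
    unfolding nearly_disjoint_iff by blast
  then show ?thesis by blast
qed

text \<open>Distinct rays intersect only where the initial part of one runs into the tail of the
  other, which is what \<open>meets\<close> records. On a homogeneous set a single such meeting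
  would make one initial part meet \<open>N + 2\<close> tails, against \<open>few\<close>.\<close>

lemma thin_nearly_disjoint:
  fixes G :: "nat \<Rightarrow> nat \<Rightarrow> 'v"
  assumes G: "nearly_disjoint W N UNIV G"
  shows "\<exists>S. infinite S \<and> inj_on (case_prod G) (S \<times> UNIV)"
proof -
  have inj: "i = k \<and> m = r" if "G i m = G k r"
    "i = k \<or> m \<le> N \<and> r \<le> N \<or> N \<le> m \<and> N \<le> r" for i m k r
    using G that unfolding nearly_disjoint_iff by blast
  define meets where "meets i j \<longleftrightarrow> (\<exists>m\<le>N. \<exists>r\<ge>N. G i m = G j r)" for i j
  \<comment> \<open>The tails are disjoint, so different tails are met at different positions
    \<open>\<mu> j \<le> N\<close>.\<close>
  have few: "card X \<le> Suc N" if "\<And>j. j \<in> X \<Longrightarrow> meets i j" for X i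
  proof -
    have "\<forall>j\<in>X. \<exists>m. m \<le> N \<and> (\<exists>r\<ge>N. G i m = G j r)" using that unfolding meets_def by blast
    then obtain \<mu> where \<mu>: "\<And>j. j \<in> X \<Longrightarrow> \<mu> j \<le> N \<and> (\<exists>r\<ge>N. G i (\<mu> j) = G j r)"
      using bchoice[of X "\<lambda>j m. m \<le> N \<and> (\<exists>r\<ge>N. G i m = G j r)"] by blast
    have "inj_on \<mu> X"
    proof (rule inj_onI)
      fix j k assume jk: "j \<in> X" "k \<in> X" "\<mu> j = \<mu> k"
      then obtain r t where "r \<ge> N" "t \<ge> N" "G j r = G k t" using \<mu>[of j] \<mu>[of k] by auto
      then show "j = k" using inj by blast
    qed
    then have "card X \<le> card {..N}" using \<mu> by (intro card_inj_on_le) auto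
    then show ?thesis by simp
  qed
  \<comment> \<open>The colour stores the two directions of meeting as binary digits, so one
    application of Ramsey's theorem settles both.\<close>
  define f :: "nat set \<Rightarrow> nat" where
    "f X = (if meets (Min X) (Max X) then 1 else 0) + (if meets (Max X) (Min X) then 2 else 0)" for X
  have "\<forall>x\<in>UNIV. \<forall>y\<in>UNIV. x \<noteq> y \<longrightarrow> f {x, y} < 4" unfolding f_def by auto
  from Ramsey2[OF infinite_UNIV_nat this] obtain Y t where Y: "infinite Y"
    and t: "\<And>x y. x \<in> Y \<Longrightarrow> y \<in> Y \<Longrightarrow> x \<noteq> y \<Longrightarrow> f {x, y} = t"
    by auto
  have ft: "(if meets x y then 1 else 0) + (if meets y x then 2 else 0) = t"
    if "x \<in> Y" "y \<in> Y" "x < y" for x y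
    using t[of x y] that unfolding f_def by simp
  have up: "meets x' y'" if "x \<in> Y" "y \<in> Y" "x < y" "meets x y" "x' \<in> Y" "y' \<in> Y" "x' < y'" for x y x' y'
    using ft[of x y] ft[of x' y'] that by (auto split: if_splits)
  have down: "meets y' x'" if "x \<in> Y" "y \<in> Y" "x < y" "meets y x" "x' \<in> Y" "y' \<in> Y" "x' < y'" for x y x' y'
    using ft[of x y] ft[of x' y'] that by (auto split: if_splits)
  have no_up: False if xy: "x \<in> Y" "y \<in> Y" "x < y" "meets x y" for x y
  proof -
    have "infinite (Y - {..x})" using Y by simp
    then obtain X where X: "finite X" "card X = N + 2" "X \<subseteq> Y - {..x}"
      using infinite_arbitrarily_large by metis
    have "meets x j" if "j \<in> X" for j
      using up[OF xy xy(1), of j] X(3) that by fastforce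
    then show False using few[of X x] X by simp
  qed
  \<comment> \<open>Here later rays meet the tails of earlier ones, so the ray with too many
    meetings is taken beyond all of \<open>X\<close>.\<close>
  have no_down: False if xy: "x \<in> Y" "y \<in> Y" "x < y" "meets y x" for x y
  proof -
    obtain X where X: "finite X" "card X = N + 2" "X \<subseteq> Y"
      using infinite_arbitrarily_large[OF Y] by metis
    obtain b where b: "X \<subseteq> {..<b}" using finite_nat_bounded[OF X(1)] by blast
    obtain i where i: "i \<in> Y" "b \<le> i" using Y unfolding infinite_nat_iff_unbounded_le by blast
    have "meets i j" if "j \<in> X" for j
      using down[OF xy, of j i] X(3) b i that by (meson lessThan_iff order_less_le_trans subsetD)
    then show False using few[of X i] X by simp
  qed
  have no: "\<not> meets x y" if "x \<in> Y" "y \<in> Y" "x \<noteq> y" for x y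
    using no_up[of x y] no_down[of y x] that by (cases x y rule: linorder_cases) auto
  have "i = k \<and> m = r" if "G i m = G k r" "i \<in> Y" "k \<in> Y" for i m k r
  proof (cases "i = k \<or> m \<le> N \<and> r \<le> N \<or> N \<le> m \<and> N \<le> r")
    case True
    then show ?thesis using inj that by blast
  next
    case False
    then have "meets i k \<or> meets k i"
      using that(1) nat_le_linear unfolding meets_def by metis
    then show ?thesis using no[of i k] no[of k i] False that by auto
  qed
  then have "inj_on (case_prod G) (Y \<times> UNIV)" by (auto intro!: inj_onI)
  then show ?thesis using Y by blast
qed

lemma infinitely_many_disjoint_rays:
  fixes W :: "nat \<Rightarrow> 'v \<Rightarrow> 'v \<Rightarrow> bool"
  assumes WE: "\<And>m. N \<le> m \<Longrightarrow> W m = E"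
    and many: "\<And>k::nat. \<exists>h. inj_on (case_prod h) ({..<k} \<times> (UNIV :: nat set)) \<and>
                 (\<forall>i<k. \<forall>m. W m (h i m) (h i (Suc m)))"
  obtains h :: "nat \<Rightarrow> nat \<Rightarrow> 'v" where "inj (case_prod h)" "\<And>i m. W m (h i m) (h i (Suc m))"
proof -
  obtain G where G: "nearly_disjoint W N (UNIV :: nat set) G"
    using infinite_nearly_disjoint[OF WE many] by blast
  obtain S where S: "infinite S" "inj_on (case_prod G) (S \<times> UNIV)"
    using thin_nearly_disjoint[OF G] by blast
  show ?thesis
  proof (rule that[of "\<lambda>i. G (enumerate S i)"])
    show "inj (\<lambda>(i, m). G (enumerate S i) m)"
    proof (rule injI, clarify)
      fix i m k r assume "G (enumerate S i) m = G (enumerate S k) r"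
      then have "enumerate S i = enumerate S k" "m = r"
        using inj_onD[OF S(2), of "(enumerate S i, m)" "(enumerate S k, r)"] enumerate_in_set[OF S(1)]
        by auto
      then show "i = k \<and> m = r" using inj_enumerate[OF S(1)] by (auto dest: injD)
    qed
    show "W m (G (enumerate S i) m) (G (enumerate S i) (Suc m))" for i m
      using G unfolding nearly_disjoint_def by auto
  qed
qed

section \<open>Copies of an oriented ray as vertex sequences\<close>

locale enumerated_ray =
  fixes R :: "('a, 'b) pre_digraph" and f :: "nat \<Rightarrow> 'a" and a :: "nat \<Rightarrow> 'b"
  assumes wf: "wf_digraph R"
    and inj_f: "inj f" and verts_R: "verts R = range f"
    and inj_a: "inj a" and arcs_R: "arcs R = range a"
    and uedge_a: "\<And>n. uedge R (a n) = {f n, f (Suc n)}"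
begin

section \<open>Distance, degree and orientation in terms of indices\<close>

lemma f_eq_iff [simp]: "f m = f n \<longleftrightarrow> m = n"
  using inj_f by (auto dest: injD)

lemma a_eq_iff [simp]: "a m = a n \<longleftrightarrow> m = n"
  using inj_a by (auto dest: injD)

lemma arc_cases:
  obtains "tail R (a n) = f (Suc n)" "head R (a n) = f n"
  | "tail R (a n) = f n" "head R (a n) = f (Suc n)"
  using uedge_a[of n] unfolding uedge_def doubleton_eq_iff by blast

lemma parcs_R: "parcs (mk_symmetric R) = (\<Union>n. {(f n, f (Suc n)), (f (Suc n), f n)})"
proof -
  have "{(tail R (a n), head R (a n)), (head R (a n), tail R (a n))} =
      {(f n, f (Suc n)), (f (Suc n), f n)}" for n
    by (cases rule: arc_cases[of n]) auto
  then show ?thesis unfolding parcs_mk_symmetric arcs_R by simp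
qed

text \<open>Each undirected step changes the index by exactly one, so no walk is shorter than the
  one along the ray.\<close>

lemma udist_first: "udist R (f 0) (f n) = n"
  unfolding udist_def
proof (rule Least_equality)
  show "(f 0, f n) \<in> parcs (mk_symmetric R) ^^ n"
    by (induction n) (auto simp: parcs_R)
  have "\<forall>m. (f 0, f m) \<in> parcs (mk_symmetric R) ^^ k \<longrightarrow> m \<le> k" for k
  proof (induction k)
    case (Suc k)
    show ?case
    proof (intro allI impI)
      fix m assume "(f 0, f m) \<in> parcs (mk_symmetric R) ^^ Suc k"
      then obtain y where y: "(f 0, y) \<in> parcs (mk_symmetric R) ^^ k" "(y, f m) \<in> parcs (mk_symmetric R)"
        by auto
      then obtain l where "y = f l" "m = Suc l \<or> l = Suc m"
        unfolding parcs_R by auto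
      then show "m \<le> Suc k" using Suc y by fastforce
    qed
  qed simp
  then show "\<And>k. (f 0, f n) \<in> parcs (mk_symmetric R) ^^ k \<Longrightarrow> n \<le> k" by blast
qed

lemma udegree_R: "udegree R (f n) = (if n = 0 then 1 else 2)"
proof -
  have "{x \<in> arcs R. f n \<in> uedge R x} = a ` {k. n = k \<or> n = Suc k}"
    unfolding arcs_R by (auto simp: uedge_a)
  then have "udegree R (f n) = card {k. n = k \<or> n = Suc k}"
    unfolding udegree_def by (simp add: card_image inj_on_def)
  moreover have "{k. n = k \<or> n = Suc k} = (if n = 0 then {0} else {n, n - 1})" by auto
  ultimately show ?thesis by auto
qed

lemma first_vertex_R: "first_vertex R = f 0"
  unfolding first_vertex_def verts_R by (rule the_equality) (auto simp: udegree_R split: if_splits)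

lemma in_oriented_iff: "in_oriented R (a n) \<longleftrightarrow> head R (a n) = f n"
  unfolding in_oriented_def first_vertex_R arcs_R
  by (cases rule: arc_cases[of n]) (auto simp: udist_first)

text \<open>The arc is only asked to exist, since parallel arcs of \<open>D\<close> serve equally
  well. Once the orientation is constant, \<open>ray_step D n\<close> no longer depends on
  \<open>n\<close>; this makes it the relation along which tails are rerouted.\<close>

definition ray_step :: "('c, 'd) pre_digraph \<Rightarrow> nat \<Rightarrow> 'c \<Rightarrow> 'c \<Rightarrow> bool" where
  "ray_step D n u v \<longleftrightarrow> (\<exists>b\<in>arcs D. if in_oriented R (a n) then tail D b = v \<and> head D b = u
                                     else tail D b = u \<and> head D b = v)"

lemma copy_imp_sequence:
  assumes sub: "subgraph C D" and iso: "digraph_iso R C"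
  shows "\<exists>g. inj g \<and> range g = verts C \<and> (\<forall>n. ray_step D n (g n) (g (Suc n)))"
proof -
  obtain \<phi> where \<phi>: "pre_digraph.digraph_isomorphism R \<phi>" and C: "C = app_iso \<phi> R"
    using iso unfolding digraph_iso_def by blast
  define g where "g n = iso_verts \<phi> (f n)" for n
  have "inj g"
    using \<phi> unfolding g_def pre_digraph.digraph_isomorphism_def verts_R
    by (intro injI) (auto dest: inj_onD)
  moreover have "range g = verts C" unfolding C g_def by (auto simp: verts_R)
  moreover have "ray_step D n (g n) (g (Suc n))" for n
  proof -
    have "iso_arcs \<phi> (a n) \<in> arcs C" unfolding C by (simp add: arcs_R)
    then have "iso_arcs \<phi> (a n) \<in> arcs D" using sub by auto
    moreover have "tail D (iso_arcs \<phi> (a n)) = iso_verts \<phi> (tail R (a n))"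
      "head D (iso_arcs \<phi> (a n)) = iso_verts \<phi> (head R (a n))"
      using sub \<phi> unfolding subgraph_def compatible_def pre_digraph.digraph_isomorphism_def C
      by (auto simp: arcs_R)
    ultimately show ?thesis
      unfolding ray_step_def g_def
      by (intro bexI[of _ "iso_arcs \<phi> (a n)"]; cases rule: arc_cases[of n]) (auto simp: in_oriented_iff)
  qed
  ultimately show ?thesis by blast
qed

text \<open>One arc is chosen for each step. The chosen arcs are distinct even if \<open>D\<close>
  has parallel arcs, because \<open>{g n, g (Suc n)}\<close> determines \<open>n\<close>.\<close>

lemma sequence_imp_copy:
  assumes D: "wf_digraph D" and g: "inj g" and step: "\<And>n. ray_step D n (g n) (g (Suc n))"
  shows "\<exists>C. subgraph C D \<and> digraph_iso R C \<and> verts C = range g"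
proof -
  obtain b where b: "\<And>n. b n \<in> arcs D"
    and bio: "\<And>n. if in_oriented R (a n) then tail D (b n) = g (Suc n) \<and> head D (b n) = g n
                  else tail D (b n) = g n \<and> head D (b n) = g (Suc n)"
    using step unfolding ray_step_def by metis
  define C where "C = \<lparr>verts = range g, arcs = range b, tail = tail D, head = head D\<rparr>"
  \<comment> \<open>With the incidence maps of \<open>D\<close> as its own, \<open>\<phi>\<close>
    sends \<open>R\<close> literally to \<open>C\<close>.\<close>
  define \<phi> where "\<phi> = \<lparr>iso_verts = g \<circ> inv f, iso_arcs = b \<circ> inv a, iso_head = head D, iso_tail = tail D\<rparr>"
  have ends: "tail D (b n) \<in> range g" "head D (b n) \<in> range g" for n
    using bio[of n] by (auto split: if_splits)
  have wfC: "wf_digraph C" using ends unfolding C_def by unfold_locales auto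
  have "g n \<in> verts D" for n
    using bio[of n] b[of n] D by (metis wf_digraph.head_in_verts wf_digraph.tail_in_verts)
  then have sub: "subgraph C D"
    using b D wfC unfolding subgraph_def compatible_def C_def by auto
  have gs: "g m = g n \<longleftrightarrow> m = n" for m n using g by (auto dest: injD)
  have "inj b"
  proof (rule injI)
    fix m n assume eq: "b m = b n"
    have "{tail D (b k), head D (b k)} = {g k, g (Suc k)}" for k
      using bio[of k] by (auto split: if_splits)
    then have "{g m, g (Suc m)} = {g n, g (Suc n)}" using eq by metis
    then show "m = n" by (auto simp: doubleton_eq_iff gs)
  qed
  then have "inj_on (b \<circ> inv a) (arcs R)"
    unfolding arcs_R using inj_a by (auto intro!: inj_onI dest: injD)
  moreover have "inj_on (g \<circ> inv f) (verts R)"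
    unfolding verts_R using inj_f g by (auto intro!: inj_onI dest: injD)
  moreover have "g (inv f (tail R (a n))) = tail D (b n)" "g (inv f (head R (a n))) = head D (b n)" for n
    using bio[of n] inj_f by (cases rule: arc_cases[of n]; simp add: in_oriented_iff)+
  ultimately have "pre_digraph.digraph_isomorphism R \<phi>"
    using wf inj_a unfolding pre_digraph.digraph_isomorphism_def \<phi>_def by (auto simp: arcs_R)
  moreover have "C = app_iso \<phi> R"
    unfolding C_def app_iso_def \<phi>_def verts_R arcs_R using inj_f inj_a by (simp add: image_comp o_def)
  ultimately have "digraph_iso R C" unfolding digraph_iso_def by blast
  then show ?thesis using sub unfolding C_def by (intro exI[of _ C]) (auto simp: C_def)
qed

lemma eventually_oriented:
  assumes "finite {x \<in> arcs R. \<not> in_oriented R x} \<or> finite {x \<in> arcs R. \<not> out_oriented R x}"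
  shows "\<exists>N c. \<forall>n\<ge>N. in_oriented R (a n) = c"
proof -
  have bounded: "\<exists>N. \<forall>n\<ge>N. P (a n)" if "finite {x \<in> arcs R. \<not> P x}" for P
  proof -
    have "finite (a -` {x \<in> arcs R. \<not> P x})" using that inj_a by (rule finite_vimageI)
    then obtain N where "a -` {x \<in> arcs R. \<not> P x} \<subseteq> {..<N}" using finite_nat_bounded by blast
    then have "\<forall>n\<ge>N. P (a n)" unfolding arcs_R by fastforce
    then show ?thesis by blast
  qed
  from assms show ?thesis
  proof
    assume "finite {x \<in> arcs R. \<not> in_oriented R x}"
    then show ?thesis using bounded[of "in_oriented R"] by auto
  next
    assume "finite {x \<in> arcs R. \<not> out_oriented R x}"
    then show ?thesis using bounded[of "out_oriented R"] unfolding out_oriented_def by auto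
  qed
qed

end

section \<open>Ubiquity of rays with eventually constant orientation\<close>

lemma oriented_ray_enumeration:
  assumes "oriented_ray R"
  shows "\<exists>f a. enumerated_ray R f a"
proof -
  obtain f :: "nat \<Rightarrow> 'a" where wf: "wf_digraph R" and f: "inj f" "verts R = range f"
    and bij: "bij_betw (uedge R) (arcs R) (range (\<lambda>n. {f n, f (Suc n)}))"
    using assms unfolding oriented_ray_def by blast
  define e where "e n = {f n, f (Suc n)}" for n
  have bij: "bij_betw (uedge R) (arcs R) (range e)" using bij unfolding e_def .
  have "inj e"
    unfolding e_def by (rule injI) (auto simp: doubleton_eq_iff inj_eq[OF f(1)])
  define a where "a = inv_into (arcs R) (uedge R) \<circ> e"
  have "bij_betw a UNIV (arcs R)"
    unfolding a_def using bij_betw_trans[OF inj_on_imp_bij_betw[OF \<open>inj e\<close>] bij_betw_inv_into[OF bij]] .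
  moreover have "uedge R (a n) = e n" for n
    unfolding a_def using bij by (simp add: bij_betw_def f_inv_into_f)
  ultimately have "enumerated_ray R f a"
    using wf f unfolding e_def by unfold_locales (auto simp: bij_betw_def wf_digraph_def)
  then show ?thesis by blast
qed

theorem theorem3p1:
  fixes R :: "('a, 'b) pre_digraph"
  assumes "oriented_ray R"
    and "finite {a \<in> arcs R. \<not> in_oriented R a} \<or> finite {a \<in> arcs R. \<not> out_oriented R a}"
  shows "ubiquitous TYPE(('c, 'd) pre_digraph) R"
  unfolding ubiquitous_def
proof (intro allI impI)
  fix D :: "('c, 'd) pre_digraph"
  assume D: "wf_digraph D"
    and many: "\<forall>k. \<exists>\<C>. finite \<C> \<and> card \<C> = k \<and> disjoint_copies D R \<C>"
  obtain f a where "enumerated_ray R f a" using oriented_ray_enumeration assms(1) by blast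
  then interpret enumerated_ray R f a .
  obtain N c where N: "\<And>n. n \<ge> N \<Longrightarrow> in_oriented R (a n) = c"
    using eventually_oriented[OF assms(2)] by blast
  \<comment> \<open>A common vertex of two sequences forces equal copies by disjointness, and then
    equal positions by injectivity within the copy.\<close>
  have seqs: "\<exists>h. inj_on (case_prod h) ({..<k} \<times> (UNIV :: nat set)) \<and>
      (\<forall>i<k. \<forall>m. ray_step D m (h i m) (h i (Suc m)))" for k :: nat
  proof -
    obtain \<C> where \<C>: "finite \<C>" "card \<C> = k" "disjoint_copies D R \<C>" using many by blast
    obtain \<kappa> where \<kappa>: "bij_betw \<kappa> {0..<k} \<C>" using ex_bij_betw_nat_finite[OF \<C>(1)] \<C>(2) by blast
    have "\<forall>C\<in>\<C>. \<exists>g. inj g \<and> range g = verts C \<and> (\<forall>n. ray_step D n (g n) (g (Suc n)))"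
      using \<C>(3) copy_imp_sequence unfolding disjoint_copies_def by blast
    then obtain g where g: "\<And>C. C \<in> \<C> \<Longrightarrow> inj (g C)" "\<And>C. C \<in> \<C> \<Longrightarrow> range (g C) = verts C"
      "\<And>C n. C \<in> \<C> \<Longrightarrow> ray_step D n (g C n) (g C (Suc n))"
      by metis
    have in\<C>: "\<kappa> i \<in> \<C>" if "i < k" for i using \<kappa> that unfolding bij_betw_def by auto
    have "i = j \<and> m = n" if ij: "i < k" "j < k" and eq: "g (\<kappa> i) m = g (\<kappa> j) n" for i j m n
    proof -
      have "g (\<kappa> i) m \<in> verts (\<kappa> i) \<inter> verts (\<kappa> j)"
        using g(2)[OF in\<C>[OF ij(1)]] g(2)[OF in\<C>[OF ij(2)]] eq by (metis IntI rangeI)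
      then have "\<kappa> i = \<kappa> j"
        using \<C>(3) in\<C> ij unfolding disjoint_copies_def pairwise_def by blast
      then have "i = j" using \<kappa> ij unfolding bij_betw_def by (auto dest: inj_onD)
      then show ?thesis using g(1)[OF in\<C>[OF ij(1)]] eq by (auto dest: injD)
    qed
    then have "inj_on (\<lambda>(i, n). g (\<kappa> i) n) ({..<k} \<times> UNIV)" by (auto intro!: inj_onI)
    then show ?thesis using g(3) in\<C> by (intro exI[of _ "\<lambda>i. g (\<kappa> i)"]) auto
  qed
  \<comment> \<open>From \<open>N\<close> on the orientation is constantly \<open>c\<close>, so the
    step relation at \<open>N\<close> serves as the relation for all tails.\<close>
  have "ray_step D m = ray_step D N" if "N \<le> m" for m
    using N[of m] N[of N] that unfolding ray_step_def by (intro ext) simp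
  then obtain h :: "nat \<Rightarrow> nat \<Rightarrow> 'c" where h: "inj (case_prod h)"
    and hstep: "\<And>i m. ray_step D m (h i m) (h i (Suc m))"
    by (rule infinitely_many_disjoint_rays[OF _ seqs]) blast+
  have heq: "i = j \<and> m = n" if "h i m = h j n" for i j m n
    using injD[OF h, of "(i, m)" "(j, n)"] that by simp
  have "\<exists>C. subgraph C D \<and> digraph_iso R C \<and> verts C = range (h i)" for i
    using sequence_imp_copy[OF D, of "h i"] hstep heq by (meson injI)
  then obtain C where C: "\<And>i. subgraph (C i) D" "\<And>i. digraph_iso R (C i)" "\<And>i. verts (C i) = range (h i)"
    by metis
  have disj: "verts (C i) \<inter> verts (C j) = {}" if "i \<noteq> j" for i j
    using heq that unfolding C(3) by blast
  \<comment> \<open>The vertex sets are nonempty, so disjoint copies are distinct and the family is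
    indeed infinite.\<close>
  have "inj C"
  proof (rule injI)
    fix i j assume "C i = C j"
    then have "verts (C i) \<inter> verts (C j) \<noteq> {}" using C(3) by simp
    then show "i = j" using disj by blast
  qed
  then have "infinite (range C)" by (rule range_inj_infinite)
  moreover have "pairwise (\<lambda>C C'. verts C \<inter> verts C' = {}) (range C)"
    unfolding pairwise_image by (intro pairwiseI impI disj)
  then have "disjoint_copies D R (range C)"
    unfolding disjoint_copies_def using C(1,2) by simp
  ultimately show "\<exists>\<C>. infinite \<C> \<and> disjoint_copies D R \<C>" by blast
qed

end
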